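(* For any finite, simple, connected, undirected graph $G$ and any integer $k\geq 1$, $\mathrm{idct}(G,k)<\infty$.
   Context: Invisible drunk robber game on $G=(V,E)$ with $k$ cops: the cops choose initial positions $x\in V^k$, then the robber's initial vertex is chosen uniformly at random from $V$; in each round first each cop moves along an edge or stays, then the robber moves to a uniformly random neighbour of his current vertex (open neighbourhood), independently of the cops. The robber is invisible: the cops do not know his position until capture, so their (possibly randomized) strategy cannot depend on the robber's positions. The capture time is the first time a cop and the robber occupy the same vertex. $\mathrm{idct}_x(G,k)$ is the smallest expected capture time achievable by the cops from initial positions $x$, and $\mathrm{idct}(G,k)=\min_{x\in V^k}\mathrm{idct}_x(G,k)$. *)

theory Defs
  imports "HOL-Probability.Probability" "Graph_Theory.Graph_Theory"
begin

text \<open>Finite simple undirected graphs are those of the locale \<^locale>\<open>graph\<close>: symmetric loop-free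
  digraphs without parallel arcs, an edge being represented by its two arcs.\<close>

definition neighbours :: "('a, 'b) pre_digraph \<Rightarrow> 'a \<Rightarrow> 'a set" where
  "neighbours G v = {u. v \<rightarrow>\<^bsub>G\<^esub> u}"

definition cop_positions :: "('a, 'b) pre_digraph \<Rightarrow> nat \<Rightarrow> 'a list set" where
  "cop_positions G k = {x. length x = k \<and> set x \<subseteq> verts G}"

definition cop_move :: "('a, 'b) pre_digraph \<Rightarrow> 'a list \<Rightarrow> 'a list \<Rightarrow> bool" where
  "cop_move G = list_all2 (\<lambda>u v. u = v \<or> u \<rightarrow>\<^bsub>G\<^esub> v)"

text \<open>The cops receive no information during the play, so a pure strategy is a legal infinite
  trajectory of cop positions, and a randomized strategy is a probability law on such trajectories.
  That it does not depend on the robber is expressed by the product measure in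
  \<open>expected_capture_time\<close> below.\<close>

definition cop_strategies ::
    "('a, 'b) pre_digraph \<Rightarrow> nat \<Rightarrow> 'a list \<Rightarrow> (nat \<Rightarrow> 'a list) measure set" where
  "cop_strategies G k x =
     {Q. prob_space Q \<and>
         sets Q = sets (\<Pi>\<^sub>M t\<in>UNIV. count_space (cop_positions G k)) \<and>
         (AE X in Q. X 0 = x \<and> (\<forall>t. cop_move G (X t) (X (Suc t))))}"

text \<open>Conditional law of the robber's vertex at time \<open>n\<close> given his trajectory \<open>\<omega>\<close> before
  time \<open>n\<close>. On the one-vertex graph the robber has no neighbour to move to; he then stays put,
  which is immaterial since every cop catches him at time 0.\<close>

definition robber_kernel :: "('a, 'b) pre_digraph \<Rightarrow> nat \<Rightarrow> (nat \<Rightarrow> 'a) \<Rightarrow> 'a measure" where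
  "robber_kernel G n \<omega> = uniform_measure (count_space (verts G))
     (case n of
        0 \<Rightarrow> verts G
      | Suc m \<Rightarrow> if neighbours G (\<omega> m) = {} then {\<omega> m} else neighbours G (\<omega> m))"

text \<open>The law of the robber's random walk, by the Ionescu-Tulcea construction.\<close>

definition robber_law :: "('a, 'b) pre_digraph \<Rightarrow> (nat \<Rightarrow> 'a) measure" where
  "robber_law G =
     (let M = (\<lambda>_. count_space (verts G))
      in projective_family.lim UNIV (Ionescu_Tulcea.CI (robber_kernel G) M) M)"

lemma Ionescu_Tulcea_robber:
  assumes "graph G" "verts G \<noteq> {}"
  shows "Ionescu_Tulcea (robber_kernel G) (\<lambda>_. count_space (verts G))"
proof -
  interpret graph G by fact
  let ?M = "\<lambda>_::nat. count_space (verts G)"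
  have prob: "prob_space (uniform_measure (count_space (verts G)) A)"
    if "A \<subseteq> verts G" "A \<noteq> {}" for A
    using that by (intro prob_space_uniform_measure)
      (auto simp: emeasure_count_space finite_subset[OF _ finite_verts])
  have nb: "neighbours G v \<subseteq> verts G" for v
    unfolding neighbours_def by (auto dest: adj_in_verts)
  have ps: "prob_space (robber_kernel G i x)" if "x \<in> space (PiM {0..<i} ?M)" for i x
  proof (cases i)
    case 0
    then show ?thesis unfolding robber_kernel_def using prob[of "verts G"] assms(2) by simp
  next
    case (Suc m)
    then have "x m \<in> verts G" using that by (auto simp: space_PiM PiE_def Pi_def)
    then show ?thesis using Suc prob nb unfolding robber_kernel_def by auto
  qed
  have sub: "robber_kernel G i x \<in> space (subprob_algebra (count_space (verts G)))"
    if "x \<in> space (PiM {0..<i} ?M)" for i x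
    using ps[OF that] by (auto simp: space_subprob_algebra robber_kernel_def prob_space_imp_subprob_space)
  show ?thesis
  proof (rule Ionescu_Tulcea.intro)
    show "robber_kernel G i \<in> PiM {0..<i} ?M \<rightarrow>\<^sub>M subprob_algebra (count_space (verts G))" for i
    proof (cases i)
      case 0
      have "(\<lambda>x. robber_kernel G 0 x) = (\<lambda>x. uniform_measure (count_space (verts G)) (verts G))"
        by (auto simp: robber_kernel_def)
      moreover have "\<dots> \<in> PiM {0..<0} ?M \<rightarrow>\<^sub>M subprob_algebra (count_space (verts G))"
        using prob[of "verts G"] assms(2)
        by (intro measurable_const) (auto simp: space_subprob_algebra prob_space_imp_subprob_space)
      ultimately show ?thesis using 0 by simp
    next
      case (Suc m)
      let ?K = "\<lambda>v. robber_kernel G (Suc m) (\<lambda>_. v)"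
      have "?K v \<in> space (subprob_algebra (count_space (verts G)))" if "v \<in> verts G" for v
      proof -
        have "prob_space (?K v)" using that prob nb unfolding robber_kernel_def by auto
        then show ?thesis
          by (auto simp: space_subprob_algebra robber_kernel_def prob_space_imp_subprob_space)
      qed
      then have "?K \<in> count_space (verts G) \<rightarrow>\<^sub>M subprob_algebra (count_space (verts G))"
        by auto
      moreover have "(\<lambda>x. x m) \<in> PiM {0..<i} ?M \<rightarrow>\<^sub>M count_space (verts G)"
        using Suc by (intro measurable_component_singleton) auto
      ultimately have "(\<lambda>x. ?K (x m)) \<in> PiM {0..<i} ?M \<rightarrow>\<^sub>M subprob_algebra (count_space (verts G))"
        by (rule measurable_compose[rotated])
      then show ?thesis using Suc by (simp add: robber_kernel_def[abs_def])
    qed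
  qed (rule ps)
qed

text \<open>Time \<open>t > 0\<close> is round \<open>t\<close>: the cops move from \<open>X (t - 1)\<close> to \<open>X t\<close> while the robber is still
  at \<open>Y (t - 1)\<close>, then the robber moves to \<open>Y t\<close>. Either half of the round may end in capture.\<close>

definition captured_at :: "(nat \<Rightarrow> 'a list) \<Rightarrow> (nat \<Rightarrow> 'a) \<Rightarrow> nat \<Rightarrow> bool" where
  "captured_at X Y t \<longleftrightarrow> (t > 0 \<and> Y (t - 1) \<in> set (X t)) \<or> Y t \<in> set (X t)"

definition capture_time :: "(nat \<Rightarrow> 'a list) \<Rightarrow> (nat \<Rightarrow> 'a) \<Rightarrow> enat" where
  "capture_time X Y = (INF t\<in>{t. captured_at X Y t}. enat t)"

lemma measurable_capture_time:
  assumes "graph G"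
  shows "(\<lambda>(X, Y). ennreal_of_enat (capture_time X Y)) \<in> borel_measurable
    ((\<Pi>\<^sub>M t\<in>UNIV. count_space (cop_positions G k)) \<Otimes>\<^sub>M (\<Pi>\<^sub>M t\<in>UNIV. count_space (verts G)))"
proof -
  interpret graph G by fact
  let ?C = "count_space (cop_positions G k)" and ?V = "count_space (verts G)"
  let ?M = "(\<Pi>\<^sub>M t\<in>(UNIV :: nat set). ?C) \<Otimes>\<^sub>M (\<Pi>\<^sub>M t\<in>(UNIV :: nat set). ?V)"
  have fin: "finite (cop_positions G k)"
    using finite_lists_length_eq[OF finite_verts, of k]
    by (simp add: cop_positions_def conj_commute)
  have eq: "?C \<Otimes>\<^sub>M ?V = count_space (cop_positions G k \<times> verts G)"
    using fin by (simp add: pair_measure_count_space)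
  have [measurable]: "Measurable.pred ?M (\<lambda>w. snd w s \<in> set (fst w t))" for s t
  proof -
    have "(\<lambda>w. (fst w t, snd w s)) \<in> ?M \<rightarrow>\<^sub>M ?C \<Otimes>\<^sub>M ?V"
      by measurable
    moreover have "Measurable.pred (?C \<Otimes>\<^sub>M ?V) (\<lambda>(x, y). y \<in> set x)"
      unfolding eq by simp
    ultimately show ?thesis
      by (auto dest: measurable_compose)
  qed
  have ct: "capture_time X Y = (if \<exists>t. captured_at X Y t then enat (LEAST t. captured_at X Y t) else \<infinity>)"
    for X :: "nat \<Rightarrow> 'a list" and Y
  proof (cases "\<exists>t. captured_at X Y t")
    case True
    then have "captured_at X Y (LEAST t. captured_at X Y t)"
      by (rule LeastI_ex)
    then have "capture_time X Y = enat (LEAST t. captured_at X Y t)"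
      unfolding capture_time_def
      by (intro antisym INF_lower INF_greatest) (simp_all add: Least_le)
    with True show ?thesis by simp
  qed (simp add: capture_time_def top_enat_def)
  show ?thesis
    unfolding split_beta' ct captured_at_def by measurable
qed

definition expected_capture_time ::
    "('a, 'b) pre_digraph \<Rightarrow> (nat \<Rightarrow> 'a list) measure \<Rightarrow> ennreal" where
  "expected_capture_time G Q =
     (\<integral>\<^sup>+ (X, Y). ennreal_of_enat (capture_time X Y) \<partial>(Q \<Otimes>\<^sub>M robber_law G))"

definition idct_from :: "('a, 'b) pre_digraph \<Rightarrow> nat \<Rightarrow> 'a list \<Rightarrow> ennreal" where
  "idct_from G k x = (INF Q\<in>cop_strategies G k x. expected_capture_time G Q)"

definition idct :: "('a, 'b) pre_digraph \<Rightarrow> nat \<Rightarrow> ennreal" where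
  "idct G k = (MIN x\<in>cop_positions G k. idct_from G k x)"

end

theory Submission
  imports Defs
begin

text \<open>The cops stand still forever on a vertex \<open>v\<close>, so that the capture time is at most the hitting
  time of \<open>v\<close> by the robber's random walk. This has finite expectation because there is a function
  \<open>h \<ge> 0\<close> on the vertices whose average over the neighbours of any \<open>u \<noteq> v\<close> is at most \<open>h u - 1\<close>:
  if \<open>S n\<close> is the event that \<open>v\<close> has not been visited up to time \<open>n\<close>, then
  \<open>E[S (n + 1) h(Y (n + 1))] + P(S n) \<le> E[S n h(Y n)]\<close>, and summing over \<open>n\<close> bounds
  \<open>\<Sum>n. P(S n)\<close> by \<open>max h\<close>.\<close>

section \<open>One-step integration for laws of random processes\<close>

context Ionescu_Tulcea
begin

text \<open>\<open>CI\<close> projects a long enough iterated kernel onto a finite index set; for an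
  initial segment nothing is projected away. This makes the recursion of \<open>C\<close> available
  for marginals of the limit.\<close>

lemma CI_Ico: "CI {0..<n} = C 0 n (\<lambda>_. undefined)"
proof (rule measure_eqI)
  have u: "(\<lambda>_. undefined) \<in> space (PiM {0..<0} M)" by (simp add: space_PiM)
  then show "sets (CI {0..<n}) = sets (C 0 n (\<lambda>_. undefined))"
    using sets_C[of _ 0 n] by (simp add: CI_def)
  fix X assume "X \<in> sets (CI {0..<n})"
  then have "X \<in> sets (PiM {0..<n} M)" by (simp add: CI_def)
  then show "emeasure (CI {0..<n}) X = emeasure (C 0 n (\<lambda>_. undefined)) X"
    using sets.sets_into_space[of X "PiM {0..<n} M"]
    by (simp add: emeasure_CI[of _ n] prod_emb_id space_PiM)
qed

text \<open>The total mass can be read off the marginal on the empty index set, which is a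
  probability measure.\<close>

lemma prob_space_lim: "prob_space PF.lim"
proof (rule prob_space_distrD)
  show "(\<lambda>Y. restrict Y {}) \<in> PF.lim \<rightarrow>\<^sub>M PiM {} M"
    by (auto simp: measurable_cong_sets[OF PF.sets_lim refl] intro: measurable_restrict_subset)
  show "prob_space (distr PF.lim (PiM {} M) (\<lambda>Y. restrict Y {}))"
    using PF.prob_space_P[of "{}"] by (simp only: distr_lim finite.emptyI empty_subsetI)
qed

lemma nn_integral_lim:
  assumes [measurable]: "f \<in> borel_measurable (PiM {0..<n} M)"
  shows "(\<integral>\<^sup>+Y. f (restrict Y {0..<n}) \<partial>PF.lim) = (\<integral>\<^sup>+\<omega>. f \<omega> \<partial>C 0 n (\<lambda>_. undefined))"
proof -
  have "(\<integral>\<^sup>+\<omega>. f \<omega> \<partial>distr PF.lim (PiM {0..<n} M) (\<lambda>Y. restrict Y {0..<n}))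
      = (\<integral>\<^sup>+Y. f (restrict Y {0..<n}) \<partial>PF.lim)"
    by (intro nn_integral_distr) (auto simp: measurable_cong_sets[OF PF.sets_lim refl] intro: measurable_restrict_subset)
  then show ?thesis by (simp add: distr_lim CI_Ico)
qed

text \<open>The law of the first \<open>n + 1\<close> coordinates is that of the first
  \<open>n\<close> followed by the kernel \<open>P n\<close>, so the last coordinate can be
  integrated out first. This plays the part of conditioning on the past.\<close>

lemma nn_integral_lim_Suc:
  assumes f[measurable]: "f \<in> borel_measurable (PiM {0..<Suc n} M)"
  shows "(\<integral>\<^sup>+Y. f (restrict Y {0..<Suc n}) \<partial>PF.lim) =
    (\<integral>\<^sup>+Y. (\<integral>\<^sup>+y. f ((restrict Y {0..<n})(n := y)) \<partial>P n (restrict Y {0..<n})) \<partial>PF.lim)"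
proof -
  have u: "(\<lambda>_. undefined) \<in> space (PiM {0..<0} M)" by (simp add: space_PiM)
  let ?F = "\<lambda>\<omega>. \<integral>\<^sup>+x. f x \<partial>eP n \<omega>"
  have F: "?F \<in> borel_measurable (PiM {0..<n} M)"
    by measurable
  have "(\<integral>\<^sup>+Y. f (restrict Y {0..<Suc n}) \<partial>PF.lim) = (\<integral>\<^sup>+x. f x \<partial>C 0 (Suc n) (\<lambda>_. undefined))"
    by (rule nn_integral_lim[OF f])
  also have "\<dots> = (\<integral>\<^sup>+\<omega>. ?F \<omega> \<partial>C 0 n (\<lambda>_. undefined))"
  proof -
    have "sets (C 0 n (\<lambda>_. undefined)) = sets (PiM {0..<n} M)"
      using sets_C[OF u, of n] by simp
    then have "eP n \<in> C 0 n (\<lambda>_. undefined) \<rightarrow>\<^sub>M subprob_algebra (PiM {0..<Suc n} M)"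
      using measurable_eP[of n] by (subst measurable_cong_sets[OF _ refl])
    then show ?thesis by (simp add: nn_integral_bind[OF f])
  qed
  also have "\<dots> = (\<integral>\<^sup>+Y. ?F (restrict Y {0..<n}) \<partial>PF.lim)"
    by (rule nn_integral_lim[OF F, symmetric])
  also have "\<dots> = (\<integral>\<^sup>+Y. (\<integral>\<^sup>+y. f ((restrict Y {0..<n})(n := y)) \<partial>P n (restrict Y {0..<n})) \<partial>PF.lim)"
    by (intro nn_integral_cong nn_integral_eP f) (auto simp: space_PiM)
  finally show ?thesis .
qed

end

section \<open>Hitting times of the random walk\<close>

lemma (in graph) finite_neighbours: "finite (neighbours G u)"
  by (rule finite_subset[OF _ finite_verts]) (auto simp: neighbours_def dest: adj_in_verts)

text \<open>With \<open>d\<close> the distance to \<open>v\<close>, \<open>L\<close> its maximum and \<open>B\<close> twice the number of vertices, take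
  \<open>h = B ^ L - B ^ (L - d)\<close>: the neighbour closer to \<open>v\<close> alone makes the average of
  \<open>B ^ (L - d)\<close> over the neighbours at least twice its value at \<open>u\<close>.\<close>

lemma (in graph) hitting_potential:
  assumes conn: "connected G" and v: "v \<in> verts G"
  obtains h :: "'a \<Rightarrow> nat" where
    "\<And>u. u \<in> verts G - {v} \<Longrightarrow> neighbours G u \<noteq> {} \<and>
      (\<Sum>w\<in>neighbours G u. Suc (h w)) \<le> card (neighbours G u) * h u"
proof -
  define d where "d u = (LEAST n. (u, v) \<in> arcs_ends G ^^ n)" for u
  define L where "L = Max (d ` verts G)"
  define B where "B = 2 * card (verts G)"
  define g where "g u = B ^ (L - d u)" for u
  have B: "B \<ge> 1"
    using v by (auto simp: B_def Suc_le_eq card_gt_0_iff)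
  have gB: "g u \<le> B ^ L" for u
    using B unfolding g_def by (intro power_increasing) auto
  have "neighbours G u \<noteq> {} \<and> (\<Sum>w\<in>neighbours G u. Suc (B ^ L - g w))
      \<le> card (neighbours G u) * (B ^ L - g u)"
    if u: "u \<in> verts G - {v}" for u
  proof -
    let ?S = "neighbours G u"
    have "u \<rightarrow>\<^sup>* v"
      using symmetric_connected_imp_strongly_connected[OF sym_arcs conn] u v
      by (auto simp: strongly_connected_def)
    then have "(u, v) \<in> (arcs_ends G)\<^sup>*" by (rule reachable_rtranclI)
    then have *: "(u, v) \<in> arcs_ends G ^^ d u"
      unfolding d_def by (metis LeastI_ex rtrancl_imp_relpow)
    \<comment> \<open>Distance 0 would force \<open>u = v\<close>, as the zeroth relational power is
      the identity. The first arc of a shortest walk then leads to a neighbour \<open>w\<close>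
      closer to \<open>v\<close>.\<close>
    with u obtain m where m: "d u = Suc m" by (cases "d u") auto
    with * obtain w where w: "u \<rightarrow> w" "(w, v) \<in> arcs_ends G ^^ m"
      by (metis relpow_Suc_D2)
    then have dw: "d w < d u" using m by (auto simp: d_def[of w] intro: Least_le le_imp_less_Suc)
    have du: "d u \<le> L" unfolding L_def using u by auto
    have wS: "w \<in> ?S" using w by (simp add: neighbours_def)
    have card: "card ?S \<le> card (verts G)"
      by (rule card_mono) (auto simp: neighbours_def dest: adj_in_verts)
    \<comment> \<open>For \<open>h = B ^ L - g\<close> the claim amounts to this lower bound on the
      sum of \<open>g\<close>. Since \<open>g u \<ge> 1\<close>, \<open>g u + 1\<close> is at most
      \<open>2 * g u\<close>; the factor \<open>B\<close> gained at \<open>w\<close> pays for this 2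
      and for the degree.\<close>
    have "card ?S * (g u + 1) \<le> card (verts G) * (2 * g u)"
      using card B by (intro mult_mono) (auto simp: g_def Suc_le_eq)
    also have "\<dots> = B ^ Suc (L - d u)" by (simp add: g_def B_def)
    also have "\<dots> \<le> g w"
      unfolding g_def using B dw du by (intro power_increasing) auto
    also have "\<dots> \<le> (\<Sum>w\<in>?S. g w)"
      using wS by (intro member_le_sum finite_neighbours) auto
    finally have "card ?S * (g u + 1) \<le> (\<Sum>w\<in>?S. g w)" .
    \<comment> \<open>Natural subtraction truncates, so both sides are compared through additive
      identities, valid because \<open>g \<le> B ^ L\<close>.\<close>
    moreover have "(\<Sum>w\<in>?S. B ^ L - g w) + (\<Sum>w\<in>?S. g w) = card ?S * B ^ L"
      using gB by (simp add: sum.distrib[symmetric])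
    moreover have "card ?S * (B ^ L - g u) + card ?S * g u = card ?S * B ^ L"
      using gB[of u] by (simp add: add_mult_distrib2[symmetric])
    ultimately show ?thesis using wS by (auto simp: sum_Suc)
  qed
  then show thesis by (rule that)
qed

lemma (in graph) nn_integral_robber_kernel_Suc:
  assumes "neighbours G (\<omega> n) \<noteq> {}"
  shows "(\<integral>\<^sup>+w. f w \<partial>robber_kernel G (Suc n) \<omega>) =
    (\<Sum>w\<in>neighbours G (\<omega> n). f w) / of_nat (card (neighbours G (\<omega> n)))"
proof -
  let ?S = "neighbours G (\<omega> n)"
  have sub: "?S \<subseteq> verts G" by (auto simp: neighbours_def dest: adj_in_verts)
  have "(\<integral>\<^sup>+w. f w * indicator ?S w \<partial>count_space (verts G)) = (\<Sum>w\<in>verts G. f w * indicator ?S w)"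
    by (intro nn_integral_count_space_finite finite_verts)
  also have "\<dots> = (\<Sum>w\<in>?S. f w)"
    using sub by (intro sum.mono_neutral_cong_right) auto
  finally show ?thesis
    using sub assms by (simp add: robber_kernel_def nn_integral_uniform_measure finite_neighbours)
qed

text \<open>The series is the tail-sum form of the expected time of the first visit to
  \<open>v\<close>.\<close>

lemma (in graph) expected_hitting_time_finite:
  assumes conn: "connected G" and v: "v \<in> verts G"
  shows "(\<Sum>n. emeasure (robber_law G) {Y \<in> space (robber_law G). \<forall>i\<le>n. Y i \<noteq> v}) < \<infinity>"
proof -
  let ?M = "\<lambda>_::nat. count_space (verts G)"
  interpret R: Ionescu_Tulcea "robber_kernel G" ?M
    using v by (intro Ionescu_Tulcea_robber graph_axioms) auto
  have law: "robber_law G = R.PF.lim" by (simp add: robber_law_def Let_def)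
  note [measurable_cong] = R.PF.sets_lim
  interpret PL: prob_space R.PF.lim by (rule R.prob_space_lim)
  obtain h :: "'a \<Rightarrow> nat" where h: "\<And>u. u \<in> verts G - {v} \<Longrightarrow> neighbours G u \<noteq> {} \<and>
      (\<Sum>w\<in>neighbours G u. Suc (h w)) \<le> card (neighbours G u) * h u"
    using hitting_potential[OF assms] by blast
  define S where "S n Y = (of_bool (\<forall>i\<le>n. Y i \<noteq> v) :: ennreal)" for n :: nat and Y
  define U where "U n = (\<integral>\<^sup>+Y. S n Y * of_nat (h (Y n)) \<partial>R.PF.lim)" for n
  define p where "p n = (\<integral>\<^sup>+Y. S n Y \<partial>R.PF.lim)" for n
  have step: "U (Suc n) + p n \<le> U n" for n
  proof -
    \<comment> \<open>The summand 1 in \<open>Suc\<close> accounts for \<open>p n\<close>. Using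
      \<open>S n\<close> instead of \<open>S (Suc n)\<close> only enlarges the integrand and makes
      the indicator independent of the last move.\<close>
    define F where "F \<omega> = S n \<omega> * of_nat (Suc (h (\<omega> (Suc n))))" for \<omega>
    have hm: "(\<lambda>\<omega>. of_nat (f (\<omega> i)) :: ennreal) \<in> borel_measurable (PiM I ?M)"
      if "i \<in> I" for f :: "'a \<Rightarrow> nat" and i I
      by (rule measurable_compose[OF measurable_component_singleton[OF that]]) simp
    have SF: "S n \<in> borel_measurable (PiM {0..<Suc (Suc n)} ?M)"
      unfolding S_def by measurable
    have S: "S m \<in> borel_measurable (PiM UNIV ?M)" for m
      unfolding S_def by measurable
    have F: "F \<in> borel_measurable (PiM {0..<Suc (Suc n)} ?M)"
      unfolding F_def by (rule borel_measurable_times_ennreal[OF SF hm[of _ _ "\<lambda>w. Suc (h w)"]]) auto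
    have "U (Suc n) + p n = (\<integral>\<^sup>+Y. S (Suc n) Y * of_nat (h (Y (Suc n))) + S n Y \<partial>R.PF.lim)"
      unfolding U_def p_def
      by (rule nn_integral_add[symmetric])
        (auto simp: measurable_cong_sets[OF R.PF.sets_lim refl]
          intro!: borel_measurable_times_ennreal[OF S hm[of _ _ h]] S)
    also have "\<dots> \<le> (\<integral>\<^sup>+Y. F (restrict Y {0..<Suc (Suc n)}) \<partial>R.PF.lim)"
      by (intro nn_integral_mono) (auto simp: F_def S_def add.commute dest: le_SucI)
    also have "\<dots> = (\<integral>\<^sup>+Y. (\<integral>\<^sup>+y. F ((restrict Y {0..<Suc n})(Suc n := y))
        \<partial>robber_kernel G (Suc n) (restrict Y {0..<Suc n})) \<partial>R.PF.lim)"
      by (rule R.nn_integral_lim_Suc[OF F])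
    also have "\<dots> \<le> U n"
      unfolding U_def
    proof (intro nn_integral_mono)
      fix Y assume Y: "Y \<in> space R.PF.lim"
      let ?\<omega> = "restrict Y {0..<Suc n}"
      have F': "F (?\<omega>(Suc n := y)) = S n Y * of_nat (Suc (h y))" for y
        by (auto simp: F_def S_def)
      have "(\<integral>\<^sup>+y. S n Y * of_nat (Suc (h y)) \<partial>robber_kernel G (Suc n) ?\<omega>) \<le> S n Y * of_nat (h (Y n))"
      \<comment> \<open>After a visit to \<open>v\<close> both sides vanish; before it, the
        inequality for \<open>h\<close> at \<open>Y n\<close>, divided by the degree,
        applies.\<close>
      proof (cases "\<forall>i\<le>n. Y i \<noteq> v")
        case True
        then have "Y n \<in> verts G - {v}" using Y by (auto simp: space_PiM)
        note hY = h[OF this]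
        let ?N = "neighbours G (Y n)"
        have "(\<integral>\<^sup>+y. S n Y * of_nat (Suc (h y)) \<partial>robber_kernel G (Suc n) ?\<omega>)
            = of_nat (\<Sum>w\<in>?N. Suc (h w)) / of_nat (card ?N)"
          using hY True by (simp add: S_def nn_integral_robber_kernel_Suc del: of_nat_Suc)
        also have "\<dots> \<le> of_nat (card ?N * h (Y n)) / of_nat (card ?N)"
          using hY by (intro divide_right_mono_ennreal of_nat_mono) auto
        also have "\<dots> = of_nat (h (Y n))"
          using hY finite_neighbours by (simp add: mult.commute ennreal_mult_divide_eq)
        finally show ?thesis using True by (simp add: S_def)
      qed (auto simp: S_def)
      then show "(\<integral>\<^sup>+y. F (?\<omega>(Suc n := y)) \<partial>robber_kernel G (Suc n) ?\<omega>) \<le> S n Y * of_nat (h (Y n))"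
        unfolding F' .
    qed
    finally show ?thesis .
  qed
  \<comment> \<open>Telescoping, with \<open>U m\<close> kept on the left to avoid subtraction in
    \<open>ennreal\<close>.\<close>
  have "(\<Sum>n<m. p n) + U m \<le> U 0" for m
  proof (induction m)
    case (Suc m)
    have "(\<Sum>n<Suc m. p n) + U (Suc m) = (\<Sum>n<m. p n) + (U (Suc m) + p m)"
      by (simp add: ac_simps)
    also have "\<dots> \<le> (\<Sum>n<m. p n) + U m" by (intro add_left_mono step)
    also have "\<dots> \<le> U 0" by (rule Suc)
    finally show ?case .
  qed simp
  then have "(\<Sum>n<m. p n) \<le> U 0" for m
    using order_trans[of "\<Sum>n<m. p n" "(\<Sum>n<m. p n) + U m" "U 0"] by (simp add: add_increasing2)
  then have "(\<Sum>n. p n) \<le> U 0"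
    by (simp add: suminf_eq_SUP SUP_le_iff)
  \<comment> \<open>The sum of \<open>h\<close> over all vertices serves as a crude upper bound for
    its maximum.\<close>
  also have "U 0 \<le> (\<integral>\<^sup>+Y. of_nat (\<Sum>u\<in>verts G. h u) \<partial>R.PF.lim)"
    unfolding U_def
  proof (intro nn_integral_mono)
    fix Y assume "Y \<in> space R.PF.lim"
    then have "Y 0 \<in> verts G" by (auto simp: space_PiM)
    then have "h (Y 0) \<le> (\<Sum>u\<in>verts G. h u)" by (intro member_le_sum) auto
    then show "S 0 Y * of_nat (h (Y 0)) \<le> of_nat (\<Sum>u\<in>verts G. h u)"
      by (auto simp: S_def simp del: of_nat_sum)
  qed
  also have "\<dots> < \<infinity>" using PL.emeasure_space_1 by (simp add: of_nat_less_top del: of_nat_sum)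
  finally have "(\<Sum>n. p n) < \<infinity>" .
  moreover have "p n = emeasure R.PF.lim {Y \<in> space R.PF.lim. \<forall>i\<le>n. Y i \<noteq> v}" for n
  proof -
    have "p n = (\<integral>\<^sup>+Y. indicator {Y \<in> space R.PF.lim. \<forall>i\<le>n. Y i \<noteq> v} Y \<partial>R.PF.lim)"
      unfolding p_def S_def by (intro nn_integral_cong) (auto simp: indicator_def)
    also have "\<dots> = emeasure R.PF.lim {Y \<in> space R.PF.lim. \<forall>i\<le>n. Y i \<noteq> v}"
      by (rule nn_integral_indicator) measurable
    finally show ?thesis .
  qed
  ultimately show ?thesis by (simp add: law)
qed

section \<open>Capture by motionless cops\<close>

text \<open>The series counts the naturals below \<open>x\<close> and diverges for infinite
  \<open>x\<close>. It turns a capture time into a sum over survival events.\<close>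

lemma ennreal_of_enat_le_suminf: "ennreal_of_enat x \<le> (\<Sum>n. of_bool (enat n < x))"
proof (cases x)
  case (enat m)
  have "(\<Sum>n. of_bool (enat n < x) :: ennreal) = (\<Sum>n<m. of_bool (enat n < x))"
    using enat by (intro suminf_finite) auto
  also have "\<dots> = of_nat m" using enat by simp
  finally show ?thesis using enat by simp
next
  case infinity
  have "of_nat m \<le> (\<Sum>n. 1 :: ennreal)" for m
    using sum_le_suminf[of "\<lambda>_. 1 :: ennreal" "{..<m}"] by simp
  then have "(\<Sum>n. 1 :: ennreal) = top"
    by (metis ennreal_Ex_less_of_nat leD top.not_eq_extremum)
  then show ?thesis using infinity by simp
qed

theorem theorem6p2:
  fixes G :: "('a, 'b) pre_digraph" and k :: nat
  assumes "graph G" and "Digraph_Component.connected G" and "k \<ge> 1"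
  shows "idct G k < \<infinity>"
proof -
  interpret graph G by fact
  obtain v where v: "v \<in> verts G"
    using assms(2) by (auto simp: Digraph_Component.connected_def strongly_connected_def)
  define x where "x = replicate k v"
  have x: "x \<in> cop_positions G k" and vx: "v \<in> set x"
    using v assms(3) by (auto simp: x_def cop_positions_def)
  have fin: "finite (cop_positions G k)"
    using finite_lists_length_eq[OF finite_verts, of k]
    by (simp add: cop_positions_def conj_commute)
  let ?C = "\<Pi>\<^sub>M t\<in>(UNIV :: nat set). count_space (cop_positions G k)"
  let ?V = "\<lambda>_::nat. count_space (verts G)"
  \<comment> \<open>A deterministic strategy is a Dirac law, here at the constant
    trajectory.\<close>
  let ?Q = "return ?C (\<lambda>_. x)"
  interpret R: Ionescu_Tulcea "robber_kernel G" ?V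
    using v by (intro Ionescu_Tulcea_robber graph_axioms) auto
  have law: "robber_law G = R.PF.lim" by (simp add: robber_law_def Let_def)
  interpret L: prob_space "robber_law G" unfolding law by (rule R.prob_space_lim)
  have sets_law: "sets (robber_law G) = sets (PiM UNIV ?V)" by (simp add: law)
  note [measurable_cong] = sets_law
  have xs: "(\<lambda>_. x) \<in> space ?C" using x by (auto simp: space_PiM)
  have "AE X in ?Q. \<forall>t. X t = x"
    using fin by (subst AE_return[OF xs]) (simp_all, measurable)
  then have "AE X in ?Q. X 0 = x \<and> (\<forall>t. cop_move G (X t) (X (Suc t)))"
    by eventually_elim (simp add: cop_move_def list_all2_same)
  then have Q: "?Q \<in> cop_strategies G k x"
    using prob_space_return[OF xs] by (simp add: cop_strategies_def)
  have "idct G k \<le> idct_from G k x"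
    unfolding idct_def using fin x by (intro Min_le) auto
  also have "\<dots> \<le> expected_capture_time G ?Q"
    unfolding idct_from_def by (rule INF_lower[OF Q])
  \<comment> \<open>Tonelli's theorem splits the product integral, and the Dirac law evaluates the
    outer one at the constant trajectory.\<close>
  also have "\<dots> = (\<integral>\<^sup>+Y. ennreal_of_enat (capture_time (\<lambda>_. x) Y) \<partial>robber_law G)"
  proof -
    have m: "(\<lambda>(X, Y). ennreal_of_enat (capture_time X Y)) \<in> borel_measurable (?C \<Otimes>\<^sub>M robber_law G)"
      using measurable_capture_time[OF graph_axioms, of k] by simp
    have "(\<lambda>(X, Y). ennreal_of_enat (capture_time X Y)) \<in> borel_measurable (?Q \<Otimes>\<^sub>M robber_law G)"
      using m by (subst measurable_cong_sets[OF sets_pair_measure_cong refl]) auto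
    then have "expected_capture_time G ?Q = (\<integral>\<^sup>+X. \<integral>\<^sup>+Y. ennreal_of_enat (capture_time X Y) \<partial>robber_law G \<partial>?Q)"
      unfolding expected_capture_time_def by (subst L.nn_integral_fst[symmetric]) auto
    also have "\<dots> = (\<integral>\<^sup>+Y. ennreal_of_enat (capture_time (\<lambda>_. x) Y) \<partial>robber_law G)"
      using L.borel_measurable_nn_integral_fst[OF m] by (intro nn_integral_return xs) simp
    finally show ?thesis .
  qed
  also have "\<dots> \<le> (\<integral>\<^sup>+Y. (\<Sum>n. indicator {Y \<in> space (robber_law G). \<forall>i\<le>n. Y i \<noteq> v} Y) \<partial>robber_law G)"
  proof (intro nn_integral_mono)
    fix Y assume Y: "Y \<in> space (robber_law G)"
    \<comment> \<open>A visit to \<open>v\<close> at time \<open>i\<close> is a capture at time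
      \<open>i\<close>, so survival past \<open>n\<close> excludes every visit up to and including
      time \<open>n\<close>.\<close>
    have "capture_time (\<lambda>_. x) Y \<le> enat i" if "Y i = v" for i
      unfolding capture_time_def using that vx by (intro INF_lower) (auto simp: captured_at_def)
    then have le: "Y i \<noteq> v" if "i \<le> n" "enat n < capture_time (\<lambda>_. x) Y" for i n
      using that by (metis enat_ord_simps(1) leD order_trans)
    have "ennreal_of_enat (capture_time (\<lambda>_. x) Y) \<le> (\<Sum>n. of_bool (enat n < capture_time (\<lambda>_. x) Y))"
      by (rule ennreal_of_enat_le_suminf)
    also have "\<dots> \<le> (\<Sum>n. indicator {Y \<in> space (robber_law G). \<forall>i\<le>n. Y i \<noteq> v} Y)"
      using Y le by (intro suminf_le) (auto simp: indicator_def)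
    finally show "ennreal_of_enat (capture_time (\<lambda>_. x) Y)
      \<le> (\<Sum>n. indicator {Y \<in> space (robber_law G). \<forall>i\<le>n. Y i \<noteq> v} Y)" .
  qed
  also have "\<dots> = (\<Sum>n. emeasure (robber_law G) {Y \<in> space (robber_law G). \<forall>i\<le>n. Y i \<noteq> v})"
    by (subst nn_integral_suminf) (auto intro!: suminf_cong nn_integral_indicator)
  also have "\<dots> < \<infinity>"
    by (rule expected_hitting_time_finite[OF assms(2) v])
  finally show ?thesis .
qed

end
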